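(* Let $D$ be the diamond, i.e. the poset $\{0,1\}^2$ under componentwise comparison. In the category of posets and weakly increasing functions, the product $D \times D$ has undefined alternation diameter.
   Context: A weakly increasing function between posets $(A,\leq_A)$ and $(B,\leq_B)$ is $f : A \to B$ such that $a \leq_A b \implies f(a) \leq_B f(b)$. Products in this category are Cartesian products with componentwise comparison. For a product $A \times B$ with projections $\pi_A, \pi_B$, let $G = \mathrm{Aut}(A \times B)$, $G_L = \{ g \in G : \pi_B \circ g = \pi_B \}$ and $G_R = \{ g \in G : \pi_A \circ g = \pi_A \}$; these are subgroups of $G$. The alternation diameter of $A \times B$ is undefined if $G$ is not generated by $G_L \cup G_R$. *)

theory Defs
  imports "HOL-Library.Product_Order" "HOL-Algebra.Generated_Groups"
begin

(* Posets are types of class order, morphisms are functions satisfying mono, and the product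
   is the type 'a \<times> 'b with the componentwise order (not the lexicographic one).*)

definition Aut :: "('a::order \<Rightarrow> 'a) monoid" where
  "Aut = \<lparr>carrier = {g. mono g \<and> (\<exists>h. mono h \<and> g \<circ> h = id \<and> h \<circ> g = id)},
          monoid.mult = (\<circ>), one = id\<rparr>"

definition G_L :: "('a::order \<times> 'b::order \<Rightarrow> 'a \<times> 'b) set" where
  "G_L = {g \<in> carrier Aut. snd \<circ> g = snd}"

definition G_R :: "('a::order \<times> 'b::order \<Rightarrow> 'a \<times> 'b) set" where
  "G_R = {g \<in> carrier Aut. fst \<circ> g = fst}"

definition alternation_diameter_undefined :: "'a::order itself \<Rightarrow> 'b::order itself \<Rightarrow> bool" where
  "alternation_diameter_undefined _ _ \<longleftrightarrow>
     generate (Aut :: ('a \<times> 'b \<Rightarrow> 'a \<times> 'b) monoid) (G_L \<union> G_R) \<noteq> carrier Aut"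

(* bool is ordered by False < True *)
type_synonym diamond = "bool \<times> bool"

lemma group_Aut: "group (Aut :: ('a::order \<Rightarrow> 'a) monoid)"
proof (rule groupI)
  fix f g :: "'a \<Rightarrow> 'a"
  assume "f \<in> carrier Aut" and "g \<in> carrier Aut"
  then obtain f' g' where "mono f" "mono f'" "f \<circ> f' = id" "f' \<circ> f = id"
    and "mono g" "mono g'" "g \<circ> g' = id" "g' \<circ> g = id"
    by (auto simp: Aut_def)
  then have "mono (f \<circ> g)" "mono (g' \<circ> f')"
      "(f \<circ> g) \<circ> (g' \<circ> f') = id" "(g' \<circ> f') \<circ> (f \<circ> g) = id"
    by (auto simp: mono_def fun_eq_iff)
  then show "f \<otimes>\<^bsub>Aut\<^esub> g \<in> carrier Aut"
    unfolding Aut_def by (simp, blast)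
next
  fix f :: "'a \<Rightarrow> 'a"
  assume "f \<in> carrier Aut"
  then show "\<exists>h\<in>carrier Aut. h \<otimes>\<^bsub>Aut\<^esub> f = \<one>\<^bsub>Aut\<^esub>"
    by (auto simp: Aut_def)
qed (auto simp: Aut_def mono_def fun_eq_iff)

lemma subgroup_G_L: "subgroup (G_L :: ('a::order \<times> 'b::order \<Rightarrow> 'a \<times> 'b) set) Aut"
proof (rule group.subgroupI [OF group_Aut])
  fix f :: "'a \<times> 'b \<Rightarrow> 'a \<times> 'b"
  assume f: "f \<in> G_L"
  then have "f \<in> carrier Aut" "snd \<circ> f = snd"
    by (auto simp: G_L_def)
  moreover have "f \<circ> inv\<^bsub>Aut\<^esub> f = id"
    using group.r_inv [OF group_Aut \<open>f \<in> carrier Aut\<close>] by (simp add: Aut_def)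
  ultimately have "snd \<circ> inv\<^bsub>Aut\<^esub> f = snd"
    by (metis comp_assoc comp_id)
  then show "inv\<^bsub>Aut\<^esub> f \<in> G_L"
    using group.inv_closed [OF group_Aut \<open>f \<in> carrier Aut\<close>] by (simp add: G_L_def)
next
  fix f g :: "'a \<times> 'b \<Rightarrow> 'a \<times> 'b"
  assume "f \<in> G_L" "g \<in> G_L"
  then show "f \<otimes>\<^bsub>Aut\<^esub> g \<in> G_L"
    using monoid.m_closed [OF group.is_monoid [OF group_Aut], of f g]
    by (auto simp: G_L_def) (simp add: Aut_def comp_assoc [symmetric])
next
  have "id \<in> (G_L :: ('a \<times> 'b \<Rightarrow> 'a \<times> 'b) set)"
    using monoid.one_closed [OF group.is_monoid [OF group_Aut]]
    by (auto simp: G_L_def Aut_def)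
  then show "(G_L :: ('a \<times> 'b \<Rightarrow> 'a \<times> 'b) set) \<noteq> {}" by blast
qed (auto simp: G_L_def)

lemma subgroup_G_R: "subgroup (G_R :: ('a::order \<times> 'b::order \<Rightarrow> 'a \<times> 'b) set) Aut"
proof (rule group.subgroupI [OF group_Aut])
  fix f :: "'a \<times> 'b \<Rightarrow> 'a \<times> 'b"
  assume f: "f \<in> G_R"
  then have "f \<in> carrier Aut" "fst \<circ> f = fst"
    by (auto simp: G_R_def)
  moreover have "f \<circ> inv\<^bsub>Aut\<^esub> f = id"
    using group.r_inv [OF group_Aut \<open>f \<in> carrier Aut\<close>] by (simp add: Aut_def)
  ultimately have "fst \<circ> inv\<^bsub>Aut\<^esub> f = fst"
    by (metis comp_assoc comp_id)
  then show "inv\<^bsub>Aut\<^esub> f \<in> G_R"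
    using group.inv_closed [OF group_Aut \<open>f \<in> carrier Aut\<close>] by (simp add: G_R_def)
next
  fix f g :: "'a \<times> 'b \<Rightarrow> 'a \<times> 'b"
  assume "f \<in> G_R" "g \<in> G_R"
  then show "f \<otimes>\<^bsub>Aut\<^esub> g \<in> G_R"
    using monoid.m_closed [OF group.is_monoid [OF group_Aut], of f g]
    by (auto simp: G_R_def) (simp add: Aut_def comp_assoc [symmetric])
next
  have "id \<in> (G_R :: ('a \<times> 'b \<Rightarrow> 'a \<times> 'b) set)"
    using monoid.one_closed [OF group.is_monoid [OF group_Aut]]
    by (auto simp: G_R_def Aut_def)
  then show "(G_R :: ('a \<times> 'b \<Rightarrow> 'a \<times> 'b) set) \<noteq> {}" by blast
qed (auto simp: G_R_def)

end

theory Submission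
  imports Defs
begin

text \<open>
  Every element of \<open>G_L \<union> G_R\<close> preserves the slice \<open>A \<times> {\<bottom>}\<close>: elements of \<open>G_L\<close> fix the
  second coordinate, and elements of \<open>G_R\<close> act on each fibre \<open>{a} \<times> B\<close> by an order automorphism,
  which fixes \<open>\<bottom>\<close>. Exchanging the two middle coordinates of \<open>{0,1}\<^sup>2 \<times> {0,1}\<^sup>2\<close> is an automorphism
  that does not preserve this slice.
\<close>

lemma G_R_snd_bot:
  fixes g :: "'a::order \<times> 'b::order_bot \<Rightarrow> 'a \<times> 'b"
  assumes "g \<in> G_R"
  shows "snd (g (a, bot)) = bot"
proof -
  from assms obtain h where "mono g" and gh: "g \<circ> h = id" and fst_g: "fst \<circ> g = fst"
    by (auto simp: G_R_def Aut_def)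
  have "fst \<circ> h = fst"
    using gh fst_g by (metis comp_assoc comp_id)
  \<comment> \<open>\<open>h\<close> keeps \<open>(a, bot)\<close> in its fibre, where
    \<open>(a, bot)\<close> is least; applying \<open>g\<close> turns this into an upper bound on
    \<open>g (a, bot)\<close>.\<close>
  then have "(a, bot) \<le> h (a, bot)"
    by (simp add: less_eq_prod_def fun_eq_iff)
  with \<open>mono g\<close> have "g (a, bot) \<le> g (h (a, bot))"
    by (rule monoD)
  also have "\<dots> = (a, bot)"
    using gh by (simp add: fun_eq_iff)
  finally show ?thesis
    by (simp add: less_eq_prod_def bot_unique)
qed

lemma generate_snd_bot:
  fixes g :: "'a::order \<times> 'b::order_bot \<Rightarrow> 'a \<times> 'b"
  assumes "g \<in> generate Aut (G_L \<union> G_R)"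
  shows "snd (g (a, bot)) = bot"
proof -
  have gen: "snd (h (a, bot)) = bot"
    if "h \<in> G_L \<union> G_R" for h :: "'a \<times> 'b \<Rightarrow> 'a \<times> 'b" and a
    using that by (auto simp: G_R_snd_bot) (simp add: G_L_def fun_eq_iff)
  show ?thesis
    using assms
  proof (induction arbitrary: a rule: generate.induct)
    case one
    then show ?case by (simp add: Aut_def)
  next
    case (incl h)
    then show ?case by (rule gen)
  next
    case (inv h)
    \<comment> \<open>\<open>G_L\<close> and \<open>G_R\<close> are closed under inverses, so this
      reduces to a generator.\<close>
    then have "inv\<^bsub>Aut\<^esub> h \<in> G_L \<union> G_R"
      using subgroup.m_inv_closed [OF subgroup_G_L] subgroup.m_inv_closed [OF subgroup_G_R] by auto
    then show ?case by (rule gen)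
  next
    case (eng h1 h2)
    \<comment> \<open>\<open>h2\<close> acts first and may move the first coordinate, so the
      hypothesis on \<open>h1\<close> is needed at \<open>a'\<close>.\<close>
    obtain a' where "h2 (a, bot) = (a', bot)"
      using eng.IH(2) by (metis prod.collapse)
    with eng.IH(1) show ?case
      by (simp add: Aut_def)
  qed
qed

theorem proposition2: "alternation_diameter_undefined TYPE(diamond) TYPE(diamond)"
proof -
  define s :: "diamond \<times> diamond \<Rightarrow> diamond \<times> diamond"
    where "s = (\<lambda>((a, b), (c, d)). ((a, c), (b, d)))"
  have "mono s" "s \<circ> s = id"
    by (auto simp: s_def mono_def less_eq_prod_def fun_eq_iff)
  then have "s \<in> carrier Aut"
    by (auto simp: Aut_def)
  moreover have "s \<notin> generate Aut (G_L \<union> G_R)"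
  proof
    assume "s \<in> generate Aut (G_L \<union> G_R)"
    \<comment> \<open>The image is \<open>((False, False), (True, False))\<close>, outside the
      slice.\<close>
    then have "snd (s ((False, True), bot)) = bot"
      by (rule generate_snd_bot)
    then show False
      by (simp add: s_def bot_prod_def)
  qed
  ultimately show ?thesis
    unfolding alternation_diameter_undefined_def by blast
qed

end
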